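(* Consider the discrete complexity measure $C(\boldsymbol\beta)=\|\boldsymbol\beta\|_0=\#\{j:\beta_j\ne0\}$ on $\mathbb R^p$, and let $l_n(\boldsymbol\theta,\sigma;\mathcal D)$ be (the average over the $n$ observations of) twice the negative log-likelihood of the Gaussian law, $$l_n(\boldsymbol\theta,\sigma;\mathcal D)=\frac{1}{\sigma^2}\frac{\|\mathbf y-\boldsymbol\theta\|_2^2}{n}+\log(2\pi\sigma^2).$$ Then, with the identity transformations $(g,\phi)=(\mathrm{id},\mathrm{id})$, i.e. with $L(\boldsymbol\beta,\beta_0,\sigma;\mathcal D)=l_n(\beta_0\mathbf 1_n+X\boldsymbol\beta,\sigma;\mathcal D)$, the zero-thresholding function of the information criterion $\mathrm{IC}=L(\boldsymbol\beta,\beta_0,\sigma;\mathcal D)+\lambda C(\boldsymbol\beta)$ is $$\lambda_0(L,\mathcal D)=\max_{s=1,\dots,\min(p,n-2)}\frac1s\log\left(\frac{\mathrm{RSS}_0}{\mathrm{RSS}_s}\right),$$ where $$\mathrm{RSS}_s:=\min_{\beta_0\in\mathbb R,\ \boldsymbol\beta\in\Omega_s}\|\mathbf y-\beta_0\mathbf 1_n-X\boldsymbol\beta\|_2^2,\qquad \Omega_s=\{\boldsymbol\beta\in\mathbb R^p:\|\boldsymbol\beta\|_0=s\},$$ and the resulting information criterion is finite-sample pivotal.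
   Context: $\mathcal D=(X,\mathbf y)$ with $X\in\mathbb R^{n\times p}$ fixed, $n\ge3$, $p\ge1$. The minimum in $\mathrm{RSS}_s$ is understood as an infimum where not attained. The information criterion is minimized over $\beta_0\in\mathbb R$, $\sigma>0$ and $\boldsymbol\beta\in\mathbb R^p$ with sparsity $s=\|\boldsymbol\beta\|_0\in\{0,1,\dots,\min(p,n-2)\}$; profiling over $\beta_0$, $\sigma$ and $\boldsymbol\beta\in\Omega_s$ for each fixed $s$ gives a criterion depending on $s$ only. Zero-thresholding function (here): the smallest value $\lambda_0(L,\mathcal D)$ such that $s=0$ (i.e. $\hat{\boldsymbol\beta}=\mathbf 0$) is a minimizer of the profile criterion over $s$ if and only if $\lambda\ge\lambda_0(L,\mathcal D)$. Finite-sample pivotal: when $\mathbf Y_0=\beta_0\mathbf 1_n+\sigma\boldsymbol\epsilon$ with $\boldsymbol\epsilon\sim N(\mathbf 0,I_n)$ (the Gaussian pure-noise model, $\boldsymbol\beta=\mathbf 0$), the distribution of $\Lambda=\lambda_0(L,(X,\mathbf Y_0))$ does not depend on $(\beta_0,\sigma)\in\mathbb R\times(0,\infty)$. *)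

theory Defs
  imports "HOL-Probability.Probability"
begin

text \<open>
  The sample size is \<open>CARD('n)\<close>, the number of covariates is \<open>CARD('p)\<close>. A data set is a pair
  \<open>(X, y)\<close>, and a loss takes the arguments \<open>\<beta>\<close>, \<open>\<beta>\<^sub>0\<close>, \<open>\<sigma>\<close> and the data set.
\<close>

type_synonym ('n, 'p) dataset = "(real ^ 'p ^ 'n) \<times> (real ^ 'n)"

type_synonym ('n, 'p) loss = "real ^ 'p \<Rightarrow> real \<Rightarrow> real \<Rightarrow> ('n, 'p) dataset \<Rightarrow> real"

definition ones :: "real ^ 'n" where
  "ones = (\<chi> i. 1)"

definition l0_norm :: "real ^ 'p \<Rightarrow> nat" where
  "l0_norm b = card {j. b $ j \<noteq> 0}"

definition Omega :: "nat \<Rightarrow> (real ^ 'p) set" where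
  "Omega s = {b. l0_norm b = s}"

definition RSS :: "nat \<Rightarrow> ('n::finite, 'p::finite) dataset \<Rightarrow> real" where
  "RSS s D = (INF (b0, b) \<in> UNIV \<times> Omega s. (norm (snd D - b0 *\<^sub>R ones - fst D *v b))\<^sup>2)"

definition gauss_nll :: "real ^ 'n \<Rightarrow> real \<Rightarrow> ('n::finite, 'p::finite) dataset \<Rightarrow> real" where
  "gauss_nll \<theta> \<sigma> D = 1 / \<sigma>\<^sup>2 * ((norm (snd D - \<theta>))\<^sup>2 / real CARD('n)) + ln (2 * pi * \<sigma>\<^sup>2)"

lemma gauss_nll_eq_log_likelihood:
  fixes D :: "('n::finite, 'p::finite) dataset" and \<theta> :: "real ^ 'n"
  assumes "\<sigma> > 0"
  shows "gauss_nll \<theta> \<sigma> D =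
    (\<Sum>i\<in>UNIV. - 2 * ln (normal_density (\<theta> $ i) \<sigma> (snd D $ i))) / real CARD('n)"
proof -
  have pt: "- 2 * ln (normal_density m \<sigma> x) = (x - m)\<^sup>2 / \<sigma>\<^sup>2 + ln (2 * pi * \<sigma>\<^sup>2)" for m x :: real
  proof -
    have pos: "2 * pi * \<sigma>\<^sup>2 > 0" using assms by simp
    have "ln (normal_density m \<sigma> x)
        = ln (1 / sqrt (2 * pi * \<sigma>\<^sup>2)) + ln (exp (- (x - m)\<^sup>2 / (2 * \<sigma>\<^sup>2)))"
      unfolding normal_density_def using pos by (intro ln_mult_pos) auto
    also have "ln (1 / sqrt (2 * pi * \<sigma>\<^sup>2)) = - (ln (2 * pi * \<sigma>\<^sup>2) / 2)"
      using pos by (simp only: ln_div ln_sqrt real_sqrt_gt_zero ln_one) (simp add: ln_sqrt ln_div)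
    finally show ?thesis by simp
  qed
  have nrm: "(norm (snd D - \<theta>))\<^sup>2 = (\<Sum>i\<in>UNIV. (snd D $ i - \<theta> $ i)\<^sup>2)"
    by (simp add: norm_vec_def L2_set_def sum_nonneg)
  show ?thesis
    unfolding pt gauss_nll_def nrm
    by (simp add: sum.distrib add_divide_distrib flip: sum_divide_distrib)
qed

definition gauss_loss :: "('n::finite, 'p::finite) loss" where
  "gauss_loss b b0 \<sigma> D = gauss_nll (b0 *\<^sub>R ones + fst D *v b) \<sigma> D"

definition info_criterion ::
    "('n::finite, 'p::finite) loss \<Rightarrow> real \<Rightarrow> real ^ 'p \<Rightarrow> real \<Rightarrow> real \<Rightarrow> ('n, 'p) dataset \<Rightarrow> real" where
  "info_criterion L lam b b0 \<sigma> D = L b b0 \<sigma> D + lam * real (l0_norm b)"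

text \<open>
  The profile takes extended real values: it is \<open>-\<infinity>\<close> at every \<open>s\<close> for which the residual sum
  of squares has infimum zero.
\<close>

definition profile_ic ::
    "('n::finite, 'p::finite) loss \<Rightarrow> real \<Rightarrow> ('n, 'p) dataset \<Rightarrow> nat \<Rightarrow> ereal" where
  "profile_ic L lam D s =
     (INF (b, b0, \<sigma>) \<in> Omega s \<times> UNIV \<times> {0<..}. ereal (info_criterion L lam b b0 \<sigma> D))"

definition zero_is_minimizer ::
    "('n::finite, 'p::finite) loss \<Rightarrow> real \<Rightarrow> ('n, 'p) dataset \<Rightarrow> bool" where
  "zero_is_minimizer L lam D \<longleftrightarrow>
     is_arg_min (profile_ic L lam D) (\<lambda>s. s \<le> min CARD('p) (CARD('n) - 2)) 0"

text \<open>
  Thresholds are extended reals as well: \<open>\<infinity>\<close> if \<open>s = 0\<close> is a minimizer for no real penalty,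
  and \<open>-\<infinity>\<close> if it is one for every real penalty.
\<close>

definition is_zero_threshold ::
    "('n::finite, 'p::finite) loss \<Rightarrow> ('n, 'p) dataset \<Rightarrow> ereal \<Rightarrow> bool" where
  "is_zero_threshold L D l \<longleftrightarrow> (\<forall>lam::real. zero_is_minimizer L lam D \<longleftrightarrow> l \<le> ereal lam)"

definition zero_threshold :: "('n::finite, 'p::finite) loss \<Rightarrow> ('n, 'p) dataset \<Rightarrow> ereal" where
  "zero_threshold L D = (LEAST l. is_zero_threshold L D l)"

text \<open>
  The logarithm on \<open>[0, \<infinity>]\<close>. Division of extended reals satisfies \<open>x / 0 = \<infinity>\<close> for \<open>x > 0\<close> and
  \<open>0 / 0 = 0\<close>, so \<open>ext_ln (ereal a / ereal b)\<close> is \<open>\<infinity>\<close> for \<open>a > 0 = b\<close> and \<open>-\<infinity>\<close> for \<open>a = b = 0\<close>.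
\<close>

definition ext_ln :: "ereal \<Rightarrow> ereal" where
  "ext_ln x = (if x \<le> 0 then -\<infinity> else if x = \<infinity> then \<infinity> else ereal (ln (real_of_ereal x)))"

lemma ext_ln_ratio:
  "a > 0 \<Longrightarrow> b > 0 \<Longrightarrow> ext_ln (ereal a / ereal b) = ereal (ln (a / b))"
  "a > 0 \<Longrightarrow> ext_ln (ereal a / ereal 0) = \<infinity>"
  "ext_ln (ereal 0 / ereal 0) = -\<infinity>"
  by (auto simp: ext_ln_def divide_ereal_def divide_inverse not_le)

definition std_gaussian :: "(real ^ 'n::finite) measure" where
  "std_gaussian =
     distr (\<Pi>\<^sub>M i\<in>(UNIV :: 'n set). density lborel (\<lambda>x. ennreal (std_normal_density x)))
           borel (\<lambda>x. \<chi> i. x i)"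

lemma prob_space_std_gaussian: "prob_space (std_gaussian :: (real ^ 'n::finite) measure)"
proof -
  let ?N = "density lborel (\<lambda>x. ennreal (std_normal_density x))"
  let ?P = "\<Pi>\<^sub>M i\<in>(UNIV :: 'n set). ?N"
  have "prob_space ?P"
    by (intro prob_space_PiM prob_space_normal_density) simp
  moreover have "(\<lambda>x. \<chi> i. x i) \<in> ?P \<rightarrow>\<^sub>M (borel :: (real ^ 'n) measure)"
  proof (subst borel_measurable_euclidean_space, intro ballI)
    fix v :: "real ^ 'n" assume "v \<in> Basis"
    then obtain i where v: "v = axis i 1"
      by (auto simp: Basis_vec_def)
    have "(\<lambda>x. x i) \<in> ?P \<rightarrow>\<^sub>M ?N"
      by (rule measurable_component_singleton) simp
    then have "(\<lambda>x. x i) \<in> borel_measurable ?P"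
      by simp
    then show "(\<lambda>x. (\<chi> i. x i) \<bullet> v) \<in> borel_measurable ?P"
      by (simp add: v inner_axis)
  qed
  ultimately show ?thesis
    unfolding std_gaussian_def by (rule prob_space.prob_space_distr)
qed

definition pure_noise :: "real \<Rightarrow> real \<Rightarrow> real ^ 'n \<Rightarrow> real ^ 'n" where
  "pure_noise b0 \<sigma> e = b0 *\<^sub>R ones + \<sigma> *\<^sub>R e"

text \<open>
  Measurability is part of the notion, since \<open>distr\<close> carries no information for a map that is not
  measurable.
\<close>

definition finite_sample_pivotal ::
    "('n::finite, 'p::finite) loss \<Rightarrow> real ^ 'p ^ 'n \<Rightarrow> bool" where
  "finite_sample_pivotal L X \<longleftrightarrow>
     (\<forall>b0 \<sigma>. \<sigma> > 0 \<longrightarrow>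
        (\<lambda>e. zero_threshold L (X, pure_noise b0 \<sigma> e)) \<in> borel_measurable std_gaussian) \<and>
     (\<forall>b0 \<sigma> b0' \<sigma>'. \<sigma> > 0 \<longrightarrow> \<sigma>' > 0 \<longrightarrow>
        distr std_gaussian borel (\<lambda>e. zero_threshold L (X, pure_noise b0 \<sigma> e)) =
        distr std_gaussian borel (\<lambda>e. zero_threshold L (X, pure_noise b0' \<sigma>' e)))"

end

theory Submission
  imports Defs
begin

text \<open>
  For a residual sum of squares \<open>r\<close>, minimising \<open>r / (n \<sigma>\<^sup>2) + ln (2 \<pi> \<sigma>\<^sup>2)\<close> over \<open>\<sigma>\<close> gives
  \<open>1 + ln (2 \<pi> r / n)\<close>, and \<open>-\<infinity>\<close> if \<open>r = 0\<close>. Both cases are covered by saying that a real \<open>c\<close>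
  is a lower bound iff \<open>n exp (c - 1) / (2 \<pi>) \<le> r\<close>. In this form the infimum over \<open>\<beta>\<close> and
  \<open>\<beta>\<^sub>0\<close> is immediate, and \<open>s = 0\<close> is a minimiser iff \<open>RSS\<^sub>0 \<le> RSS\<^sub>s exp (\<lambda> s)\<close> for
  all \<open>s\<close>. Pivotality holds because \<open>RSS\<^sub>s\<close> is the squared distance of \<open>y\<close> to a set that is
  invariant under scaling and under translation along \<open>ones\<close>, so that all ratios
  \<open>RSS\<^sub>0 / RSS\<^sub>s\<close> agree at \<open>\<beta>\<^sub>0 ones + \<sigma> e\<close> and at \<open>e\<close>.
\<close>

section \<open>Residual sums of squares as squared distances\<close>

definition fitted_values :: "real ^ 'p ^ 'n \<Rightarrow> nat \<Rightarrow> (real ^ 'n) set" where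
  "fitted_values X s = (\<lambda>(b0, b). b0 *\<^sub>R ones + X *v b) ` (UNIV \<times> Omega s)"

definition threshold_term :: "nat \<Rightarrow> ('n::finite, 'p::finite) dataset \<Rightarrow> ereal" where
  "threshold_term s D = ereal (1 / real s) * ext_ln (ereal (RSS 0 D) / ereal (RSS s D))"

lemma Omega_nonempty:
  assumes "s \<le> CARD('p)"
  shows "Omega s \<noteq> ({} :: (real ^ 'p::finite) set)"
proof -
  obtain J :: "'p set" where J: "card J = s"
    using obtain_subset_with_card_n[OF assms] by blast
  have "((\<chi> j. if j \<in> J then 1 else 0) :: real ^ 'p) \<in> Omega s"
    by (simp add: Omega_def l0_norm_def J)
  then show ?thesis by blast
qed

lemma Omega_scaleR: "b \<in> Omega s \<Longrightarrow> c \<noteq> 0 \<Longrightarrow> c *\<^sub>R b \<in> Omega s"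
  by (simp add: Omega_def l0_norm_def)

lemma fitted_values_nonempty:
  fixes X :: "real ^ 'p ^ 'n"
  shows "s \<le> CARD('p) \<Longrightarrow> fitted_values X s \<noteq> {}"
  using Omega_nonempty[of s, where 'p = 'p] by (simp add: fitted_values_def)

text \<open>The shift is absorbed by the intercept. The scale must be nonzero because
  \<open>Omega s\<close> asks for exactly \<open>s\<close> nonzero entries.\<close>

lemma fitted_values_affine:
  assumes "a \<in> fitted_values X s" "\<sigma> \<noteq> 0"
  shows "b0 *\<^sub>R ones + \<sigma> *\<^sub>R a \<in> fitted_values X s"
proof -
  obtain a0 b where b: "b \<in> Omega s" and a: "a = a0 *\<^sub>R ones + X *v b"
    using assms(1) by (auto simp: fitted_values_def)
  have "b0 *\<^sub>R ones + \<sigma> *\<^sub>R a = (b0 + \<sigma> * a0) *\<^sub>R ones + X *v (\<sigma> *\<^sub>R b)"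
    by (simp add: a algebra_simps matrix_vector_mult_scaleR)
  then show ?thesis
    unfolding fitted_values_def using Omega_scaleR[OF b assms(2)] by force
qed

text \<open>Squaring is an increasing bijection of the nonnegative reals, so it commutes with
  infima, attained or not. This matters because \<open>fitted_values X s\<close> need not be
  closed.\<close>

lemma INF_dist_square:
  assumes "A \<noteq> {}"
  shows "(INF a\<in>A. (dist y a)\<^sup>2) = (infdist y A)\<^sup>2"
proof (rule antisym)
  let ?I = "INF a\<in>A. (dist y a)\<^sup>2"
  have bdd: "bdd_below ((\<lambda>a. (dist y a)\<^sup>2) ` A)"
    by (rule bdd_belowI2[of _ 0]) simp
  have "sqrt ?I \<le> infdist y A"
    unfolding infdist_notempty[OF assms]
    by (intro cINF_greatest assms real_le_lsqrt cINF_lower2[OF bdd]) auto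
  then show "?I \<le> (infdist y A)\<^sup>2"
    by (rule sqrt_le_D)
  show "(infdist y A)\<^sup>2 \<le> ?I"
    by (intro cINF_greatest assms power_mono infdist_le infdist_nonneg)
qed

lemma RSS_eq_infdist:
  fixes X :: "real ^ 'p ^ 'n"
  assumes "s \<le> CARD('p)"
  shows "RSS s (X, y) = (infdist y (fitted_values X s))\<^sup>2"
  unfolding INF_dist_square[OF fitted_values_nonempty[OF assms], symmetric]
  by (simp add: RSS_def fitted_values_def image_image dist_norm case_prod_beta diff_diff_eq)

lemma infdist_fitted_values_pure_noise:
  assumes "fitted_values X s \<noteq> {}" "\<sigma> > 0"
  shows "infdist (pure_noise b0 \<sigma> e) (fitted_values X s) = \<sigma> * infdist e (fitted_values X s)"
proof -
  let ?S = "fitted_values X s"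
  \<comment> \<open>Stated for all shifts and scales because the inverse of
    \<open>pure_noise b0 \<sigma>\<close> is again of this form; the bound for both maps gives
    equality.\<close>
  have le: "infdist (pure_noise c \<tau> z) ?S \<le> \<tau> * infdist z ?S" if "\<tau> > 0" for c \<tau> z
  proof -
    have "infdist (pure_noise c \<tau> z) ?S / \<tau> \<le> dist z a" if a: "a \<in> ?S" for a
    proof -
      have "infdist (pure_noise c \<tau> z) ?S \<le> dist (pure_noise c \<tau> z) (c *\<^sub>R ones + \<tau> *\<^sub>R a)"
        using fitted_values_affine[OF a] \<open>\<tau> > 0\<close> by (intro infdist_le) simp
      also have "\<dots> = \<tau> * dist z a"
        using \<open>\<tau> > 0\<close> by (simp add: pure_noise_def dist_norm flip: scaleR_diff_right)
      finally show ?thesis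
        using \<open>\<tau> > 0\<close> by (simp add: divide_le_eq mult.commute)
    qed
    then have "infdist (pure_noise c \<tau> z) ?S / \<tau> \<le> infdist z ?S"
      unfolding infdist_notempty[OF assms(1), of z] by (intro cINF_greatest assms)
    then show ?thesis
      using \<open>\<tau> > 0\<close> by (simp add: divide_le_eq mult.commute)
  qed
  have "pure_noise (- b0 / \<sigma>) (1 / \<sigma>) (pure_noise b0 \<sigma> e) = e"
    using assms(2) by (simp add: pure_noise_def algebra_simps)
  then have "infdist e ?S \<le> 1 / \<sigma> * infdist (pure_noise b0 \<sigma> e) ?S"
    using le[of "1 / \<sigma>" "- b0 / \<sigma>" "pure_noise b0 \<sigma> e"] assms(2) by simp
  then show ?thesis
    using le[OF assms(2), of b0 e] assms(2) by (simp add: field_simps)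
qed

lemma RSS_pure_noise:
  fixes X :: "real ^ 'p ^ 'n"
  assumes "s \<le> CARD('p)" "\<sigma> > 0"
  shows "RSS s (X, pure_noise b0 \<sigma> e) = \<sigma>\<^sup>2 * RSS s (X, e)"
  using assms
  by (simp add: RSS_eq_infdist infdist_fitted_values_pure_noise fitted_values_nonempty
      power_mult_distrib)

lemma RSS_nonneg:
  fixes D :: "('n::finite, 'p::finite) dataset"
  assumes "s \<le> CARD('p)"
  shows "RSS s D \<ge> 0"
  using RSS_eq_infdist[OF assms, of "fst D" "snd D"] by simp

lemma le_RSS_iff:
  fixes D :: "('n::finite, 'p::finite) dataset"
  assumes "s \<le> CARD('p)"
  shows "c \<le> RSS s D \<longleftrightarrow>
    (\<forall>b0. \<forall>b \<in> Omega s. c \<le> (norm (snd D - b0 *\<^sub>R ones - fst D *v b))\<^sup>2)"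
proof -
  have "bdd_below ((\<lambda>(b0, b). (norm (snd D - b0 *\<^sub>R ones - fst D *v b))\<^sup>2) ` (UNIV \<times> Omega s))"
    by (rule bdd_belowI2[of _ 0]) auto
  moreover have "UNIV \<times> Omega s \<noteq> ({} :: (real \<times> (real ^ 'p)) set)"
    using Omega_nonempty[OF assms] by simp
  ultimately show ?thesis
    unfolding RSS_def by (subst le_cINF_iff) auto
qed

section \<open>Real lower bounds of the profile criterion\<close>

lemma le_profile_sigma_iff:
  fixes r n c :: real
  assumes "n > 0" "r \<ge> 0"
  shows "(\<forall>\<sigma>>0. c \<le> 1 / \<sigma>\<^sup>2 * (r / n) + ln (2 * pi * \<sigma>\<^sup>2)) \<longleftrightarrow> n / (2 * pi) * exp (c - 1) \<le> r"
proof
  assume *: "\<forall>\<sigma>>0. c \<le> 1 / \<sigma>\<^sup>2 * (r / n) + ln (2 * pi * \<sigma>\<^sup>2)"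
  show "n / (2 * pi) * exp (c - 1) \<le> r"
  proof (cases "r = 0")
    case True
    \<comment> \<open>The witness makes the argument of the logarithm \<open>exp (c - 1)\<close>, so
      the bound would read \<open>c \<le> c - 1\<close>: no real lower bound exists.\<close>
    have "c \<le> ln (2 * pi * (sqrt (exp (c - 1) / (2 * pi)))\<^sup>2)"
      using *[rule_format, of "sqrt (exp (c - 1) / (2 * pi))"] True by simp
    then show ?thesis by simp
  next
    case False
    then have r: "r > 0" using assms by simp
    \<comment> \<open>The witness is the minimiser, with
      \<open>\<sigma>\<^sup>2 = r / n\<close>.\<close>
    then have "c \<le> 1 + ln (2 * pi * (r / n))"
      using *[rule_format, of "sqrt (r / n)"] assms by simp
    then have "exp (c - 1) \<le> 2 * pi * (r / n)"
      using r assms by (subst ln_ge_iff[symmetric]) auto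
    then show ?thesis
      using assms by (simp add: field_simps)
  qed
next
  assume *: "n / (2 * pi) * exp (c - 1) \<le> r"
  have "0 < n / (2 * pi) * exp (c - 1)"
    using assms by simp
  with * have r: "r > 0" by linarith
  have "exp (c - 1) \<le> 2 * pi * (r / n)"
    using * assms by (simp add: field_simps)
  then have c: "c \<le> 1 + ln (2 * pi * (r / n))"
    using r assms by (subst (asm) ln_ge_iff[symmetric]) auto
  show "\<forall>\<sigma>>0. c \<le> 1 / \<sigma>\<^sup>2 * (r / n) + ln (2 * pi * \<sigma>\<^sup>2)"
  proof (intro allI impI)
    fix \<sigma> :: real assume \<sigma>: "\<sigma> > 0"
    \<comment> \<open>Optimality of \<open>\<sigma>\<^sup>2 = r / n\<close>, where
      \<open>x = 1\<close>, amounts to \<open>ln x \<le> x - 1\<close>.\<close>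
    define x where "x = 1 / \<sigma>\<^sup>2 * (r / n)"
    have x: "x > 0" using \<sigma> r assms by (simp add: x_def)
    have "2 * pi * (r / n) = x * (2 * pi * \<sigma>\<^sup>2)"
      using \<sigma> by (simp add: x_def)
    then have "ln (2 * pi * (r / n)) = ln x + ln (2 * pi * \<sigma>\<^sup>2)"
      using x \<sigma> by (simp only:) (subst ln_mult_pos, auto)
    with c ln_le_minus_one[OF x] show "c \<le> 1 / \<sigma>\<^sup>2 * (r / n) + ln (2 * pi * \<sigma>\<^sup>2)"
      unfolding x_def by linarith
  qed
qed

text \<open>The penalty is constant on \<open>Omega s\<close> and moves into the bound
  \<open>c\<close>. Being a lower bound is a universal statement, so \<sigma> can be eliminated
  first for each fixed fit.\<close>

lemma le_profile_ic_iff: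
  fixes D :: "('n::finite, 'p::finite) dataset"
  assumes "s \<le> CARD('p)"
  shows "ereal c \<le> profile_ic gauss_loss lam D s \<longleftrightarrow>
    real CARD('n) / (2 * pi) * exp (c - lam * real s - 1) \<le> RSS s D"
proof -
  have "ereal c \<le> profile_ic gauss_loss lam D s \<longleftrightarrow>
    (\<forall>b0. \<forall>b \<in> Omega s. \<forall>\<sigma>>0. c - lam * real s \<le>
      1 / \<sigma>\<^sup>2 * ((norm (snd D - b0 *\<^sub>R ones - fst D *v b))\<^sup>2 / real CARD('n)) + ln (2 * pi * \<sigma>\<^sup>2))"
    unfolding profile_ic_def le_INF_iff
    by (auto simp: info_criterion_def gauss_loss_def gauss_nll_def Omega_def diff_diff_eq
        diff_le_eq)
  also have "\<dots> \<longleftrightarrow> (\<forall>b0. \<forall>b \<in> Omega s. real CARD('n) / (2 * pi) * exp (c - lam * real s - 1)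
      \<le> (norm (snd D - b0 *\<^sub>R ones - fst D *v b))\<^sup>2)"
    by (intro all_cong1 ball_cong refl le_profile_sigma_iff) auto
  finally show ?thesis
    unfolding le_RSS_iff[OF assms] .
qed

text \<open>Allows profiles to be compared through real \<open>c\<close> only:
  \<open>-\<infinity>\<close> has no real lower bound, and \<open>\<infinity>\<close> has all of
  them.\<close>

lemma ereal_le_iff_real_lower_bounds:
  fixes x y :: ereal
  shows "x \<le> y \<longleftrightarrow> (\<forall>c. ereal c \<le> x \<longrightarrow> ereal c \<le> y)"
proof (intro iffI allI impI)
  assume *: "\<forall>c. ereal c \<le> x \<longrightarrow> ereal c \<le> y"
  show "x \<le> y"
  proof (cases x)
    case (real r)
    then show ?thesis using * by simp
  next
    case PInf
    then show ?thesis using * by (simp add: ereal_top)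
  qed simp
qed (rule order_trans)

lemma profile_ic_zero_le_iff:
  fixes D :: "('n::finite, 'p::finite) dataset"
  assumes "s \<le> CARD('p)"
  shows "profile_ic gauss_loss lam D 0 \<le> profile_ic gauss_loss lam D s \<longleftrightarrow>
    RSS 0 D \<le> RSS s D * exp (lam * real s)"
proof -
  define K where "K = real CARD('n) / (2 * pi)"
  have K: "K > 0" by (simp add: K_def)
  have "profile_ic gauss_loss lam D 0 \<le> profile_ic gauss_loss lam D s \<longleftrightarrow>
    (\<forall>c. ereal c \<le> profile_ic gauss_loss lam D 0 \<longrightarrow> ereal c \<le> profile_ic gauss_loss lam D s)"
    by (rule ereal_le_iff_real_lower_bounds)
  also have "\<dots> \<longleftrightarrow> (\<forall>c. K * exp (c - 1) \<le> RSS 0 D \<longrightarrow> K * exp (c - lam * real s - 1) \<le> RSS s D)"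
    by (simp add: le_profile_ic_iff assms K_def)
  also have "\<dots> \<longleftrightarrow>
    (\<forall>c. K * exp (c - 1) \<le> RSS 0 D \<longrightarrow> K * exp (c - 1) \<le> RSS s D * exp (lam * real s))"
  proof -
    have "K * exp (c - lam * real s - 1) = K * exp (c - 1) / exp (lam * real s)" for c
      by (simp add: exp_diff)
    then show ?thesis by (simp add: divide_le_eq)
  qed
  also have "\<dots> \<longleftrightarrow> RSS 0 D \<le> RSS s D * exp (lam * real s)"
  proof (intro iffI allI impI)
    assume *: "\<forall>c. K * exp (c - 1) \<le> RSS 0 D \<longrightarrow> K * exp (c - 1) \<le> RSS s D * exp (lam * real s)"
    show "RSS 0 D \<le> RSS s D * exp (lam * real s)"
    proof (cases "RSS 0 D = 0")
      \<comment> \<open>Here no \<open>c\<close> satisfies the premise, so nonnegativity of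
        \<open>RSS s D\<close> has to give the claim.\<close>
      case True
      then show ?thesis using RSS_nonneg[OF assms, of D] by simp
    next
      case False
      then have "RSS 0 D > 0" using RSS_nonneg[of 0 D] by simp
      \<comment> \<open>This \<open>c\<close> solves
        \<open>K * exp (c - 1) = RSS 0 D\<close>.\<close>
      then show ?thesis using *[rule_format, of "1 + ln (RSS 0 D / K)"] K by simp
    qed
  qed auto
  finally show ?thesis .
qed

section \<open>The zero threshold as a maximum\<close>

lemma threshold_term_le_iff:
  fixes D :: "('n::finite, 'p::finite) dataset"
  assumes "0 < s" "s \<le> CARD('p)"
  shows "threshold_term s D \<le> ereal lam \<longleftrightarrow> RSS 0 D \<le> RSS s D * exp (lam * real s)"
proof -
  \<comment> \<open>In the first case the term is \<open>-\<infinity>\<close>, even for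
    \<open>0 / 0\<close>, and both sides hold; in the second it is \<open>\<infinity>\<close> and
    both fail.\<close>
  consider "RSS 0 D = 0" | "RSS 0 D > 0" "RSS s D = 0" | "RSS 0 D > 0" "RSS s D > 0"
    using RSS_nonneg[of 0 D] RSS_nonneg[OF assms(2), of D] by force
  then show ?thesis
  proof cases
    case 1
    then show ?thesis
      using assms RSS_nonneg[OF assms(2), of D]
      by (simp add: threshold_term_def ext_ln_def zero_ereal_def[symmetric])
  next
    case 2
    then show ?thesis
      using assms by (simp add: threshold_term_def ext_ln_def)
  next
    case 3
    have "threshold_term s D \<le> ereal lam \<longleftrightarrow> ln (RSS 0 D / RSS s D) \<le> lam * real s"
      unfolding threshold_term_def ext_ln_ratio(1)[OF 3] using assms by (simp add: divide_le_eq)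
    also have "\<dots> \<longleftrightarrow> RSS 0 D / RSS s D \<le> exp (lam * real s)"
      using 3 by (subst ln_le_cancel_iff[symmetric]) auto
    finally show ?thesis
      using 3 by (simp add: divide_le_eq mult.commute)
  qed
qed

lemma zero_is_minimizer_iff:
  fixes D :: "('n::finite, 'p::finite) dataset"
  shows "zero_is_minimizer gauss_loss lam D \<longleftrightarrow>
    (\<forall>s \<in> {1..min CARD('p) (CARD('n) - 2)}. threshold_term s D \<le> ereal lam)"
proof -
  have "zero_is_minimizer gauss_loss lam D \<longleftrightarrow>
    (\<forall>s \<le> min CARD('p) (CARD('n) - 2).
      profile_ic gauss_loss lam D 0 \<le> profile_ic gauss_loss lam D s)"
    unfolding zero_is_minimizer_def is_arg_min_def by (auto simp: not_less)
  also have "\<dots> \<longleftrightarrow> (\<forall>s \<in> {1..min CARD('p) (CARD('n) - 2)}.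
      profile_ic gauss_loss lam D 0 \<le> profile_ic gauss_loss lam D s)"
    (is "(\<forall>s \<le> ?m. ?P s) \<longleftrightarrow> _")
  proof (intro iffI allI impI)
    fix s assume "\<forall>s \<in> {1..?m}. ?P s" "s \<le> ?m"
    then show "?P s" by (cases "s = 0") auto
  qed auto
  also have "\<dots> \<longleftrightarrow> (\<forall>s \<in> {1..min CARD('p) (CARD('n) - 2)}. threshold_term s D \<le> ereal lam)"
    by (intro ball_cong refl) (simp add: profile_ic_zero_le_iff threshold_term_le_iff)
  finally show ?thesis .
qed

text \<open>An extended real is determined by the reals above it, so the \<open>LEAST\<close> in
  \<open>zero_threshold\<close> has at most one candidate.\<close>

lemma is_zero_threshold_unique:
  assumes "is_zero_threshold L D k" "is_zero_threshold L D l"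
  shows "k = l"
proof -
  have *: "k \<le> ereal z \<longleftrightarrow> l \<le> ereal z" for z
    using assms by (simp add: is_zero_threshold_def)
  have "k \<le> l"
    by (rule ereal_le_real) (simp add: *)
  moreover have "l \<le> k"
    by (rule ereal_le_real) (simp add: *)
  ultimately show ?thesis by simp
qed

lemma zero_threshold_eqI:
  assumes "is_zero_threshold L D l"
  shows "zero_threshold L D = l"
  unfolding zero_threshold_def
proof (rule Least_equality)
  show "is_zero_threshold L D l" by (rule assms)
next
  fix k assume "is_zero_threshold L D k"
  then have "l = k" by (rule is_zero_threshold_unique[OF assms])
  then show "l \<le> k" by simp
qed

lemma is_zero_threshold_Max:
  fixes D :: "('n::finite, 'p::finite) dataset"
  assumes "CARD('n) \<ge> 3"
  shows "is_zero_threshold gauss_loss D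
    (MAX s \<in> {1..min CARD('p) (CARD('n) - 2)}. threshold_term s D)"
proof -
  \<comment> \<open>A sample size of at least 3 puts 1 into the range; \<open>Max\<close> of an
    empty set would be unspecified.\<close>
  have "{1..min CARD('p) (CARD('n) - 2)} \<noteq> {}"
    using assms by (auto simp: Suc_le_eq)
  then show ?thesis
    unfolding is_zero_threshold_def zero_is_minimizer_iff by (subst Max_le_iff) auto
qed

section \<open>Invariance, measurability and pivotality\<close>

lemma threshold_term_pure_noise:
  fixes X :: "real ^ 'p ^ 'n"
  assumes "s \<le> CARD('p)" "\<sigma> > 0"
  shows "threshold_term s (X, pure_noise b0 \<sigma> e) = threshold_term s (X, e)"
proof -
  \<comment> \<open>The factor cancels for zero denominators too, since \<open>a / 0\<close> depends
    only on whether \<open>a\<close> vanishes.\<close>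
  have "ereal (\<sigma>\<^sup>2 * a) / ereal (\<sigma>\<^sup>2 * b) = ereal a / ereal b" if "a \<ge> 0" "b \<ge> 0" for a b
    using that assms(2)
    by (cases "b = 0"; cases "a = 0") (auto simp: divide_ereal_def divide_inverse)
  then show ?thesis
    using assms by (simp add: threshold_term_def RSS_pure_noise RSS_nonneg)
qed

lemma borel_measurable_ext_ln: "ext_ln \<in> borel_measurable borel"
  unfolding ext_ln_def[abs_def] by measurable

text \<open>The distance to a fixed set is continuous in \<open>y\<close>, hence so is each
  \<open>RSS\<close>.\<close>

lemma borel_measurable_threshold_term:
  fixes X :: "real ^ 'p ^ 'n"
  assumes "s \<le> CARD('p)"
  shows "(\<lambda>y. threshold_term s (X, y)) \<in> borel_measurable borel"
proof -
  have RSS: "(\<lambda>y. RSS t (X, y)) \<in> borel_measurable borel" if "t \<le> CARD('p)" for t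
    unfolding RSS_eq_infdist[OF that]
    by (intro borel_measurable_continuous_onI continuous_intros)
  note [measurable] = RSS[of 0] RSS[OF assms] borel_measurable_ext_ln
  show ?thesis
    unfolding threshold_term_def divide_ereal_def by simp
qed

theorem theorem11:
  fixes X :: "real ^ 'p ^ 'n"
  assumes "CARD('n) \<ge> 3" and "CARD('p) \<ge> 1"
  shows "(\<forall>y :: real ^ 'n.
            is_zero_threshold gauss_loss (X, y) (zero_threshold gauss_loss (X, y)) \<and>
            zero_threshold gauss_loss (X, y) =
              (MAX s \<in> {1..min CARD('p) (CARD('n) - 2)}.
                 ereal (1 / real s) * ext_ln (ereal (RSS 0 (X, y)) / ereal (RSS s (X, y))))) \<and>
         finite_sample_pivotal (gauss_loss :: ('n, 'p) loss) X"
proof -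
  let ?I = "{1..min CARD('p) (CARD('n) - 2)}"
  have thr: "is_zero_threshold gauss_loss (X, y) (MAX s \<in> ?I. threshold_term s (X, y))" for y
    by (rule is_zero_threshold_Max[OF assms(1)])
  note eq = zero_threshold_eqI[OF thr]
  \<comment> \<open>The thresholds agree for every noise vector \<open>e\<close>, which is stronger
    than equality in law.\<close>
  have noise: "zero_threshold gauss_loss (X, pure_noise b0 \<sigma> e) = zero_threshold gauss_loss (X, e)"
    if "\<sigma> > 0" for b0 \<sigma> e
    unfolding eq using that
    by (intro arg_cong[where f = Max] image_cong refl threshold_term_pure_noise) auto
  have "?I \<noteq> {}"
    using assms by auto
  \<comment> \<open>As a countable supremum, the maximum inherits measurability from its
    terms.\<close>
  then have "(MAX s \<in> ?I. threshold_term s (X, y)) = (SUP s \<in> ?I. threshold_term s (X, y))" for y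
    by (intro cSup_eq_Max[symmetric]) auto
  moreover have "(\<lambda>y. SUP s \<in> ?I. threshold_term s (X, y)) \<in> borel_measurable borel"
    by (intro borel_measurable_SUP borel_measurable_threshold_term) auto
  ultimately have "(\<lambda>y. zero_threshold gauss_loss (X, y)) \<in> borel_measurable borel"
    unfolding eq by simp
  then have "(\<lambda>y. zero_threshold gauss_loss (X, y)) \<in> borel_measurable std_gaussian"
    by (simp add: std_gaussian_def)
  then have "finite_sample_pivotal (gauss_loss :: ('n, 'p) loss) X"
    by (simp add: finite_sample_pivotal_def noise)
  then show ?thesis
    unfolding threshold_term_def[symmetric] using thr by (auto simp: eq)
qed

end
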